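(* Let $G$ be the graph with five vertices $A,B,C,D,E$ and exactly the seven edges $AB,\ AC,\ AD,\ BC,\ CD,\ BE,\ DE$. Then $G$ does not have an admissible labeling.
   Context: Graphs are finite, simple and undirected. Let $G$ be a graph with vertex set $V=\{v_1,\ldots,v_d\}$, $d=|V|$. For positive integers $n,s$ write $[n]=\{1,\ldots,n\}$ and let $\binom{[n]}{s}$ be the set of subsets of $[n]$ of cardinality $s$. An admissible labeling of $G$ is an injective function $\phi\colon V\to\binom{[n]}{s}$, for some choice of $n$ and $s$, such that (1) $\phi(v_1)\cup\cdots\cup\phi(v_d)=[n]$, and (2) for all vertices $v,w$, $v$ is adjacent to $w$ in $G$ if and only if $|\phi(v)\cap\phi(w)|=s-1$ (equivalently, $|\phi(v)\cup\phi(w)|=s+1$). *)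

theory Defs
  imports "Graph_Theory.Digraph" "HOL-Library.Ramsey"
begin

text \<open>Finite simple undirected graphs are the symmetric digraphs of the locale \<^locale>\<open>graph\<close>
  (finite, no loops, no multiple arcs): every undirected edge is a pair of opposite arcs.
  The set of edges forgets the orientation.\<close>

definition edge_set :: "('a, 'b) pre_digraph \<Rightarrow> 'a set set" where
  "edge_set G = {{v, w} |v w. v \<rightarrow>\<^bsub>G\<^esub> w}"

text \<open>Condition (2) may include the case \<open>v = w\<close>: neither side holds then, since \<open>s > 0\<close>. The
  natural-number subtraction \<open>s - 1\<close> does not truncate.\<close>

definition admissible_labeling ::
    "('a, 'b) pre_digraph \<Rightarrow> nat \<Rightarrow> nat \<Rightarrow> ('a \<Rightarrow> nat set) \<Rightarrow> bool" where
  "admissible_labeling G n s \<phi> \<longleftrightarrow>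
     n > 0 \<and> s > 0 \<and>
     \<phi> \<in> verts G \<rightarrow> nsets {1..n} s \<and>
     inj_on \<phi> (verts G) \<and>
     (\<Union>v\<in>verts G. \<phi> v) = {1..n} \<and>
     (\<forall>v\<in>verts G. \<forall>w\<in>verts G. v \<rightarrow>\<^bsub>G\<^esub> w \<longleftrightarrow> card (\<phi> v \<inter> \<phi> w) = s - 1)"

definition has_admissible_labeling :: "('a, 'b) pre_digraph \<Rightarrow> bool" where
  "has_admissible_labeling G \<longleftrightarrow> (\<exists>n s \<phi>. admissible_labeling G n s \<phi>)"

end

theory Submission
  imports Defs
begin

text \<open>
  An admissible labeling embeds \<^term>\<open>G\<close> as an induced subgraph of the Johnson graph, whose
  vertices are the \<open>s\<close>-sets and in which adjacent sets differ by exchanging one element. Take two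
  sets \<open>X\<close>, \<open>Y\<close> at distance two there, with \<open>X - Y = {p, q}\<close> and \<open>Y - X = {u, v}\<close>. Their common
  neighbours are obtained from \<open>X \<inter> Y\<close> by adding one of \<open>p, q\<close> and one of \<open>u, v\<close>. These four
  sets form a 4-cycle, so each common neighbour is nonadjacent to exactly one of the others
  (lemma \<open>antipode_determined\<close>).

  In the given graph, \<open>B\<close> and \<open>D\<close> are nonadjacent and have the common neighbours \<open>A\<close>, \<open>C\<close>, \<open>E\<close>,
  where \<open>E\<close> is adjacent neither to \<open>A\<close> nor to \<open>C\<close>. Hence \<open>A\<close> and \<open>C\<close> would carry the same label,
  which contradicts injectivity.
\<close>

lemma card_Int_nonadjacent:
  assumes "finite X" "finite Y" "card X = s" "card Y = s" "X \<noteq> Y" "card (X \<inter> Y) \<noteq> s - 1"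
  shows "card (X \<inter> Y) + 2 \<le> s"
proof -
  have "\<not> X \<subseteq> Y"
    using card_subset_eq[of Y X] assms(2-5) by auto
  then have "X \<inter> Y \<subset> X" by blast
  then have "card (X \<inter> Y) < s"
    using psubset_card_mono[of X "X \<inter> Y"] assms(1,3) by simp
  with assms(6) show ?thesis by linarith
qed

text \<open>
  Since \<open>Z\<close> misses one element of \<open>X\<close> and one of \<open>Y\<close>, it meets \<open>X \<inter> Y\<close> in at least \<open>s - 2\<close>
  elements. This is the largest size that \<open>X \<inter> Y\<close> can have, so \<open>Z\<close> contains \<open>X \<inter> Y\<close>; then
  \<open>Z \<inter> X\<close> and \<open>Z \<inter> Y\<close> together already have \<open>s\<close> elements and exhaust \<open>Z\<close>.
\<close>

lemma common_neighbour_between: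
  assumes fin: "finite X" "finite Y" "finite Z"
    and card: "card Z = s"
    and far: "card (X \<inter> Y) + 2 \<le> s"
    and near: "card (Z \<inter> X) = s - 1" "card (Z \<inter> Y) = s - 1"
  shows "card (X \<inter> Y) + 2 = s" and "X \<inter> Y \<subseteq> Z" and "Z \<subseteq> X \<union> Y"
proof -
  have split: "card (Z \<inter> X) + card (Z \<inter> Y) = card (Z \<inter> (X \<union> Y)) + card (Z \<inter> (X \<inter> Y))"
  proof -
    have "Z \<inter> X \<union> Z \<inter> Y = Z \<inter> (X \<union> Y)" "Z \<inter> X \<inter> (Z \<inter> Y) = Z \<inter> (X \<inter> Y)"
      by blast+
    then show ?thesis
      using card_Un_Int[of "Z \<inter> X" "Z \<inter> Y"] fin by simp
  qed
  have le_Z: "card (Z \<inter> (X \<union> Y)) \<le> s"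
    using card_mono[of Z "Z \<inter> (X \<union> Y)"] fin card by auto
  have le_XY: "card (Z \<inter> (X \<inter> Y)) \<le> card (X \<inter> Y)"
    using card_mono[of "X \<inter> Y" "Z \<inter> (X \<inter> Y)"] fin by auto
  show XY: "card (X \<inter> Y) + 2 = s"
    using split le_Z le_XY far near by linarith
  have "card (Z \<inter> (X \<inter> Y)) = card (X \<inter> Y)"
    using split le_Z le_XY far near by linarith
  then have "Z \<inter> (X \<inter> Y) = X \<inter> Y"
    using fin by (intro card_subset_eq) auto
  then show "X \<inter> Y \<subseteq> Z" by blast
  have "card (Z \<inter> (X \<union> Y)) = card Z"
    using split le_Z le_XY far near card by linarith
  then have "Z \<inter> (X \<union> Y) = Z"
    using fin by (intro card_subset_eq) auto
  then show "Z \<subseteq> X \<union> Y" by blast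
qed

text \<open>
  Both \<open>Z\<close> and \<open>W\<close> lie between \<open>X \<inter> Y\<close> and \<open>X \<union> Y\<close>. If they are nonadjacent, counting forces
  \<open>Z \<inter> W = X \<inter> Y\<close> and \<open>Z \<union> W = X \<union> Y\<close>, so \<open>Z\<close> is the complement of \<open>W\<close> in this interval. The
  right-hand side does not mention \<open>Z\<close>: two common neighbours of \<open>X\<close> and \<open>Y\<close> that are both
  nonadjacent to \<open>W\<close> coincide.
\<close>

lemma antipode_determined:
  assumes fin: "finite X" "finite Y" "finite Z" "finite W"
    and card: "card X = s" "card Y = s" "card Z = s" "card W = s"
    and far: "card (X \<inter> Y) + 2 \<le> s" "card (Z \<inter> W) + 2 \<le> s"
    and near: "card (Z \<inter> X) = s - 1" "card (Z \<inter> Y) = s - 1"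
      "card (W \<inter> X) = s - 1" "card (W \<inter> Y) = s - 1"
  shows "Z = (X \<inter> Y) \<union> ((X \<union> Y) - W)"
proof -
  note Z = common_neighbour_between[OF fin(1,2,3) card(3) far(1) near(1,2)]
  note W = common_neighbour_between[OF fin(1,2,4) card(4) far(1) near(3,4)]
  have sub: "X \<inter> Y \<subseteq> Z \<inter> W" using Z W by blast
  have le: "card (X \<inter> Y) \<le> card (Z \<inter> W)"
    using sub fin by (intro card_mono) auto
  have ZW: "card (Z \<inter> W) = card (X \<inter> Y)"
    using le far(2) Z(1) by linarith
  have int: "X \<inter> Y = Z \<inter> W"
    using sub ZW fin by (intro card_subset_eq) auto
  have "card (Z \<union> W) = card (X \<union> Y)"
    using card_Un_Int[OF fin(1,2)] card_Un_Int[OF fin(3,4)] card ZW by linarith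
  then have "Z \<union> W = X \<union> Y"
    using Z W fin by (intro card_subset_eq) auto
  with int show ?thesis by blast
qed

lemma (in graph) arc_iff_edge_set: "v \<rightarrow>\<^bsub>G\<^esub> w \<longleftrightarrow> {v, w} \<in> edge_set G"
proof
  assume "{v, w} \<in> edge_set G"
  then obtain x y where "{v, w} = {x, y}" "x \<rightarrow>\<^bsub>G\<^esub> y"
    unfolding edge_set_def by blast
  then have "v \<rightarrow>\<^bsub>G\<^esub> w \<or> w \<rightarrow>\<^bsub>G\<^esub> v"
    unfolding doubleton_eq_iff by blast
  then show "v \<rightarrow>\<^bsub>G\<^esub> w"
    using sym_arcs unfolding symmetric_def by (blast dest: symD)
next
  assume "v \<rightarrow>\<^bsub>G\<^esub> w"
  then show "{v, w} \<in> edge_set G"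
    unfolding edge_set_def by blast
qed

theorem proposition5p15:
  fixes G :: "('a, 'b) pre_digraph" and A B C D E :: 'a
  assumes "graph G"
    and "distinct [A, B, C, D, E]"
    and "verts G = {A, B, C, D, E}"
    and "edge_set G = {{A, B}, {A, C}, {A, D}, {B, C}, {C, D}, {B, E}, {D, E}}"
  shows "\<not> has_admissible_labeling G"
proof
  assume "has_admissible_labeling G"
  then obtain n s \<phi> where adm: "admissible_labeling G n s \<phi>"
    unfolding has_admissible_labeling_def by blast
  have label: "finite (\<phi> v)" "card (\<phi> v) = s" if "v \<in> verts G" for v
  proof -
    have "\<phi> v \<in> nsets {1..n} s"
      using adm that unfolding admissible_labeling_def by blast
    then show "finite (\<phi> v)" "card (\<phi> v) = s"
      unfolding nsets_def by blast+
  qed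
  have inj: "inj_on \<phi> (verts G)"
    using adm unfolding admissible_labeling_def by blast
  have adj: "card (\<phi> v \<inter> \<phi> w) = s - 1 \<longleftrightarrow> {v, w} \<in> edge_set G"
    if "v \<in> verts G" "w \<in> verts G" for v w
  proof -
    have "v \<rightarrow>\<^bsub>G\<^esub> w \<longleftrightarrow> card (\<phi> v \<inter> \<phi> w) = s - 1"
      using adm that unfolding admissible_labeling_def by blast
    then show ?thesis
      using graph.arc_iff_edge_set[OF assms(1), of v w] by simp
  qed
  have near: "card (\<phi> v \<inter> \<phi> B) = s - 1" "card (\<phi> v \<inter> \<phi> D) = s - 1" if "v \<in> {A, C, E}" for v
  proof -
    have v: "v \<in> verts G" "B \<in> verts G" "D \<in> verts G"
      using that assms(3) by auto
    have "{v, B} \<in> edge_set G" "{v, D} \<in> edge_set G"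
      using that unfolding assms(4) by (auto simp: doubleton_eq_iff)
    then show "card (\<phi> v \<inter> \<phi> B) = s - 1" "card (\<phi> v \<inter> \<phi> D) = s - 1"
      using adj v by blast+
  qed
  have far: "card (\<phi> v \<inter> \<phi> w) + 2 \<le> s" if "(v, w) \<in> {(B, D), (A, E), (C, E)}" for v w
  proof (rule card_Int_nonadjacent)
    have vw: "v \<in> verts G" "w \<in> verts G" "v \<noteq> w"
      using that assms(2,3) by auto
    show "finite (\<phi> v)" "finite (\<phi> w)" "card (\<phi> v) = s" "card (\<phi> w) = s"
      using label vw by auto
    show "\<phi> v \<noteq> \<phi> w" using inj_on_eq_iff[OF inj vw(1,2)] vw(3) by simp
    have "{v, w} \<notin> edge_set G"
      using that assms(2,4) by (auto simp: doubleton_eq_iff)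
    then show "card (\<phi> v \<inter> \<phi> w) \<noteq> s - 1" using adj vw by blast
  qed
  have "\<phi> v = (\<phi> B \<inter> \<phi> D) \<union> ((\<phi> B \<union> \<phi> D) - \<phi> E)" if "v \<in> {A, C}" for v
  proof (rule antipode_determined)
    have v: "v \<in> verts G" "B \<in> verts G" "D \<in> verts G" "E \<in> verts G"
      using that assms(3) by auto
    show "finite (\<phi> B)" "finite (\<phi> D)" "finite (\<phi> v)" "finite (\<phi> E)"
      "card (\<phi> B) = s" "card (\<phi> D) = s" "card (\<phi> v) = s" "card (\<phi> E) = s"
      using v label by blast+
    show "card (\<phi> B \<inter> \<phi> D) + 2 \<le> s" using far by blast
    show "card (\<phi> v \<inter> \<phi> E) + 2 \<le> s" using far that by blast
    show "card (\<phi> v \<inter> \<phi> B) = s - 1" "card (\<phi> v \<inter> \<phi> D) = s - 1"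
      using near that by blast+
    show "card (\<phi> E \<inter> \<phi> B) = s - 1" "card (\<phi> E \<inter> \<phi> D) = s - 1"
      using near by blast+
  qed
  then have "\<phi> A = \<phi> C" by blast
  moreover have "A \<in> verts G" "C \<in> verts G" "A \<noteq> C"
    using assms(2,3) by auto
  ultimately show False
    using inj_on_eq_iff[OF inj] by blast
qed

end
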